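(* For every real number $y$, the exponential generating functions of the Padovan hyperbolic spinors $\psi_n$ and of the Perrin hyperbolic spinors $\phi_n$ are $$\sum_{n=0}^\infty \psi_n\frac{y^n}{n!}=A\sigma_1e^{\alpha y}+B\sigma_2e^{\beta y}+C\sigma_3e^{\gamma y},\qquad \sum_{n=0}^\infty \phi_n\frac{y^n}{n!}=Ae^{\alpha y}+Be^{\beta y}+Ce^{\gamma y}.$$
   Context: Hyperbolic numbers are expressions $a+bj$ with $a,b\in\mathbb{R}$ and a unit $j\notin\mathbb{R}$, $j^2=1$; they form a commutative ring. A hyperbolic spinor is a column vector with two hyperbolic number components. Since complex coefficients occur in the formulas, the identities are read for column vectors over the commutative ring $\{a+bj: a,b\in\mathbb{C}\}$, $j^2=1$, $j$ commuting with $\mathbb{C}$; series converge coefficientwise. The Padovan numbers $(P_n)_{n\ge 0}$ are defined by $P_0=P_1=P_2=1$ and $P_{n+3}=P_{n+1}+P_n$ for $n\ge0$. The Perrin numbers $(R_n)_{n\ge 0}$ are defined by $R_0=3$, $R_1=0$, $R_2=2$ and $R_{n+3}=R_{n+1}+R_n$ for $n\ge 0$. The $n$-th Padovan hyperbolic spinor and the $n$-th Perrin hyperbolic spinor are $$\psi_n=\begin{bmatrix}P_n+P_{n+3}j\\ -P_{n+1}+P_{n+2}j\end{bmatrix},\qquad \phi_n=\begin{bmatrix}R_n+R_{n+3}j\\ -R_{n+1}+R_{n+2}j\end{bmatrix}.$$ $\alpha,\beta,\gamma$ are the three (distinct) complex roots of $x^3-x-1=0$, with $\alpha$ the real one and $\beta,\gamma$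 the complex conjugate pair ($\beta$ having positive imaginary part), and $$\sigma_1=\frac{(\beta-1)(\gamma-1)}{(\alpha-\beta)(\alpha-\gamma)},\quad \sigma_2=\frac{(\alpha-1)(\gamma-1)}{(\beta-\alpha)(\beta-\gamma)},\quad \sigma_3=\frac{(\alpha-1)(\beta-1)}{(\gamma-\alpha)(\gamma-\beta)}.$$ Moreover $$A=\begin{bmatrix}1+\alpha^3 j\\ \alpha(-1+\alpha j)\end{bmatrix},\quad B=\begin{bmatrix}1+\beta^3 j\\ \beta(-1+\beta j)\end{bmatrix},\quad C=\begin{bmatrix}1+\gamma^3 j\\ \gamma(-1+\gamma j)\end{bmatrix}.$$ *)

theory Defs
  imports "HOL-Analysis.Analysis"
begin

text \<open>\<open>Hyp a b\<close> stands for \<open>a + b j\<close> with \<open>j\<^sup>2 = 1\<close>. Coefficients are complex; hyperbolic numbers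
  proper are the elements with real \<open>a\<close>, \<open>b\<close>.\<close>

datatype hyp = Hyp (scalar_part: complex) (j_part: complex)

instantiation hyp :: comm_ring_1
begin

definition zero_hyp where "0 = Hyp 0 0"
definition one_hyp where "1 = Hyp 1 0"
definition plus_hyp where "x + y = Hyp (scalar_part x + scalar_part y) (j_part x + j_part y)"
definition minus_hyp where "x - y = Hyp (scalar_part x - scalar_part y) (j_part x - j_part y)"
definition uminus_hyp where "- x = Hyp (- scalar_part x) (- j_part x)"
definition times_hyp where
  "x * y = Hyp (scalar_part x * scalar_part y + j_part x * j_part y)
               (scalar_part x * j_part y + j_part x * scalar_part y)"

instance
  by standard
    (auto simp: zero_hyp_def one_hyp_def plus_hyp_def minus_hyp_def uminus_hyp_def times_hyp_def
      algebra_simps)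

end

definition hyp_of :: "complex \<Rightarrow> hyp" where
  "hyp_of c = Hyp c 0"

definition j_unit :: hyp where
  "j_unit = Hyp 0 1"

lemma j_unit_squared: "j_unit ^ 2 = 1"
  by (simp add: power2_eq_square j_unit_def times_hyp_def one_hyp_def)

lemma hyp_eq: "x = hyp_of (scalar_part x) + hyp_of (j_part x) * j_unit"
  by (cases x) (simp add: hyp_of_def j_unit_def times_hyp_def plus_hyp_def)

text \<open>The topology of \<open>\<complex> \<times> \<complex>\<close>, so that convergence is convergence of both coefficients.\<close>

instantiation hyp :: topological_space
begin

definition open_hyp :: "hyp set \<Rightarrow> bool" where
  "open_hyp U \<longleftrightarrow> open {(a, b). Hyp a b \<in> U}"

instance
proof
  show "open (UNIV :: hyp set)"
    by (simp add: open_hyp_def)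
next
  fix S T :: "hyp set"
  assume "open S" "open T"
  moreover have "{(a, b). Hyp a b \<in> S \<inter> T} = {(a, b). Hyp a b \<in> S} \<inter> {(a, b). Hyp a b \<in> T}"
    by auto
  ultimately show "open (S \<inter> T)"
    by (simp only: open_hyp_def open_Int)
next
  fix K :: "hyp set set"
  assume "\<forall>S\<in>K. open S"
  moreover have "{(a, b). Hyp a b \<in> \<Union> K} = (\<Union>S\<in>K. {(a, b). Hyp a b \<in> S})"
    by auto
  ultimately show "open (\<Union> K)"
    by (simp only: open_hyp_def open_UN)
qed

end

lemma tendsto_hyp_iff:
  "(f \<longlongrightarrow> l) F \<longleftrightarrow>
    ((\<lambda>x. scalar_part (f x)) \<longlongrightarrow> scalar_part l) F \<and> ((\<lambda>x. j_part (f x)) \<longlongrightarrow> j_part l) F"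
proof -
  let ?pair = "\<lambda>x. (scalar_part x, j_part x)"
  have "(f \<longlongrightarrow> l) F \<longleftrightarrow> ((\<lambda>x. ?pair (f x)) \<longlongrightarrow> ?pair l) F"
  proof
    assume f: "(f \<longlongrightarrow> l) F"
    show "((\<lambda>x. ?pair (f x)) \<longlongrightarrow> ?pair l) F"
    proof (rule topological_tendstoI)
      fix S assume S: "open S" "?pair l \<in> S"
      have "open {x. ?pair x \<in> S}"
        using S(1) by (simp add: open_hyp_def)
      from topological_tendstoD[OF f this] S(2) show "\<forall>\<^sub>F x in F. ?pair (f x) \<in> S"
        by simp
    qed
  next
    assume f: "((\<lambda>x. ?pair (f x)) \<longlongrightarrow> ?pair l) F"
    show "(f \<longlongrightarrow> l) F"
    proof (rule topological_tendstoI)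
      fix S assume "open S" "l \<in> S"
      then show "\<forall>\<^sub>F x in F. f x \<in> S"
        using topological_tendstoD[OF f, of "{(a, b). Hyp a b \<in> S}"] by (simp add: open_hyp_def)
    qed
  qed
  also have "\<dots> \<longleftrightarrow>
    ((\<lambda>x. scalar_part (f x)) \<longlongrightarrow> scalar_part l) F \<and> ((\<lambda>x. j_part (f x)) \<longlongrightarrow> j_part l) F"
    by (auto intro: tendsto_Pair dest: tendsto_fst tendsto_snd)
  finally show ?thesis .
qed

lemma scalar_part_sum: "scalar_part (sum f A) = (\<Sum>x\<in>A. scalar_part (f x))"
  by (induction A rule: infinite_finite_induct) (auto simp: zero_hyp_def plus_hyp_def)

lemma j_part_sum: "j_part (sum f A) = (\<Sum>x\<in>A. j_part (f x))"
  by (induction A rule: infinite_finite_induct) (auto simp: zero_hyp_def plus_hyp_def)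

lemma sums_hyp_vec_iff:
  fixes f :: "nat \<Rightarrow> hyp ^ 'n"
  shows "f sums s \<longleftrightarrow>
    (\<forall>i. (\<lambda>n. scalar_part (f n $ i)) sums scalar_part (s $ i) \<and>
         (\<lambda>n. j_part (f n $ i)) sums j_part (s $ i))"
proof -
  have "f sums s \<longleftrightarrow> (\<forall>i. (\<lambda>n. \<Sum>k<n. f k $ i) \<longlonglongrightarrow> s $ i)"
    unfolding sums_def
    by (auto intro: vec_tendstoI dest: tendsto_vec_nth simp flip: sum_component)
  then show ?thesis
    by (simp add: tendsto_hyp_iff scalar_part_sum j_part_sum sums_def)
qed

fun padovan :: "nat \<Rightarrow> nat" where
  "padovan 0 = 1"
| "padovan (Suc 0) = 1"
| "padovan (Suc (Suc 0)) = 1"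
| "padovan (Suc (Suc (Suc n))) = padovan (Suc n) + padovan n"

fun perrin :: "nat \<Rightarrow> nat" where
  "perrin 0 = 3"
| "perrin (Suc 0) = 0"
| "perrin (Suc (Suc 0)) = 2"
| "perrin (Suc (Suc (Suc n))) = perrin (Suc n) + perrin n"

definition padovan_spinor :: "nat \<Rightarrow> hyp ^ 2" where
  "padovan_spinor n = vector
     [of_nat (padovan n) + of_nat (padovan (n + 3)) * j_unit,
      - of_nat (padovan (n + 1)) + of_nat (padovan (n + 2)) * j_unit]"

definition perrin_spinor :: "nat \<Rightarrow> hyp ^ 2" where
  "perrin_spinor n = vector
     [of_nat (perrin n) + of_nat (perrin (n + 3)) * j_unit,
      - of_nat (perrin (n + 1)) + of_nat (perrin (n + 2)) * j_unit]"

text \<open>The columns \<open>A\<close>, \<open>B\<close>, \<open>C\<close> are the values at \<open>\<alpha>\<close>, \<open>\<beta>\<close>, \<open>\<gamma>\<close>.\<close>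

definition root_spinor :: "complex \<Rightarrow> hyp ^ 2" where
  "root_spinor x = vector
     [1 + hyp_of (x ^ 3) * j_unit,
      hyp_of x * (- 1 + hyp_of x * j_unit)]"

text \<open>\<open>\<sigma>\<^sub>1\<close>, \<open>\<sigma>\<^sub>2\<close>, \<open>\<sigma>\<^sub>3\<close> are the values at \<open>(\<alpha>, \<beta>, \<gamma>)\<close>, \<open>(\<beta>, \<alpha>, \<gamma>)\<close>, \<open>(\<gamma>, \<alpha>, \<beta>)\<close>.\<close>

definition padovan_coeff :: "complex \<Rightarrow> complex \<Rightarrow> complex \<Rightarrow> complex" where
  "padovan_coeff x u v = ((u - 1) * (v - 1)) / ((x - u) * (x - v))"

end

theory Submission
  imports Defs
begin

text \<open>Both sequences satisfy a Binet formula: the terms are \<open>p \<alpha>\<^sup>n + q \<beta>\<^sup>n + r \<gamma>\<^sup>n\<close>, with weights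
  \<open>\<sigma>\<^sub>1, \<sigma>\<^sub>2, \<sigma>\<^sub>3\<close> in the Padovan case and \<open>1, 1, 1\<close> in the Perrin case. Hence the \<open>n\<close>-th spinor is the
  combination of the root spinors with coefficients \<open>p \<alpha>\<^sup>n, q \<beta>\<^sup>n, r \<gamma>\<^sup>n\<close>, and the generating function
  is a sum of three exponential series. For \<open>n \<le> 2\<close> the Padovan weights are the values at \<open>1\<close> of the
  Lagrange basis polynomials for the nodes \<open>\<alpha>, \<beta>, \<gamma>\<close>; interpolating \<open>x\<^sup>n\<close> at these nodes and
  evaluating at \<open>1\<close> gives \<open>P\<^sub>n = 1\<close>. The Perrin initial values are power sums of the roots.\<close>

lemma scalar_part_simps [simp]:
  "scalar_part (x + y) = scalar_part x + scalar_part y"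
  "scalar_part (- x) = - scalar_part x"
  "scalar_part (x * y) = scalar_part x * scalar_part y + j_part x * j_part y"
  "scalar_part 1 = 1" "scalar_part (hyp_of c) = c" "scalar_part j_unit = 0"
  by (simp_all add: plus_hyp_def uminus_hyp_def times_hyp_def one_hyp_def hyp_of_def j_unit_def)

lemma j_part_simps [simp]:
  "j_part (x + y) = j_part x + j_part y"
  "j_part (- x) = - j_part x"
  "j_part (x * y) = scalar_part x * j_part y + j_part x * scalar_part y"
  "j_part 1 = 0" "j_part (hyp_of c) = 0" "j_part j_unit = 1"
  by (simp_all add: plus_hyp_def uminus_hyp_def times_hyp_def one_hyp_def hyp_of_def j_unit_def)

text \<open>Moves the natural entries of a spinor into the complex coefficients, where a Binet
  formula can be substituted.\<close>

lemma of_nat_hyp: "(of_nat n :: hyp) = hyp_of (of_nat n)"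
proof (induction n)
  case (Suc n)
  then show ?case by (simp add: hyp.expand)
qed (simp add: hyp_of_def zero_hyp_def)

lemma sums_hyp_vec_add:
  fixes f g :: "nat \<Rightarrow> hyp ^ 'n"
  assumes "f sums s" "g sums t"
  shows "(\<lambda>n. f n + g n) sums (s + t)"
  using assms by (auto simp: sums_hyp_vec_iff intro: sums_add)

lemma sums_hyp_of_vector_mult:
  fixes v :: "hyp ^ 'n"
  assumes "f sums s"
  shows "(\<lambda>n. hyp_of (f n) *s v) sums (hyp_of s *s v)"
  using assms by (auto simp: sums_hyp_vec_iff intro: sums_mult2)

lemma exp_sums_weighted:
  fixes p x :: complex and y :: real
  shows "(\<lambda>n. of_real (y ^ n / fact n) * (p * x ^ n)) sums (p * exp (x * of_real y))"
proof -
  have "(\<lambda>n. p * ((x * of_real y) ^ n /\<^sub>R fact n)) sums (p * exp (x * of_real y))"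
    by (intro sums_mult exp_converges)
  then show ?thesis
    by (simp add: scaleR_conv_of_real power_mult_distrib field_simps)
qed

text \<open>Shifting the index of \<open>x ^ n\<close> by k multiplies it by \<open>x ^ k\<close>.
  So the spinor built from the sequence \<open>x ^ n\<close> is \<open>x ^ n\<close> times
  \<open>root_spinor x\<close>, and linearity handles the weighted sum. Free weights let one lemma
  serve both sequences.\<close>

lemma spinor_egf:
  fixes u :: "nat \<Rightarrow> nat" and y :: real
  assumes binet: "\<And>n. of_nat (u n) = p * a ^ n + q * b ^ n + r * c ^ n"
  shows "(\<lambda>n. hyp_of (of_real (y ^ n / fact n)) *s
            (vector [of_nat (u n) + of_nat (u (n + 3)) * j_unit,
                     - of_nat (u (n + 1)) + of_nat (u (n + 2)) * j_unit] :: hyp ^ 2)) sums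
         (hyp_of (p * exp (a * of_real y)) *s root_spinor a
          + hyp_of (q * exp (b * of_real y)) *s root_spinor b
          + hyp_of (r * exp (c * of_real y)) *s root_spinor c)"
proof -
  let ?t = "\<lambda>w x n. of_real (y ^ n / fact n) * (w * x ^ n) :: complex"
  have "hyp_of (of_real (y ^ n / fact n)) *s
            (vector [of_nat (u n) + of_nat (u (n + 3)) * j_unit,
                     - of_nat (u (n + 1)) + of_nat (u (n + 2)) * j_unit] :: hyp ^ 2)
        = hyp_of (?t p a n) *s root_spinor a + hyp_of (?t q b n) *s root_spinor b
          + hyp_of (?t r c n) *s root_spinor c" for n
    unfolding vec_eq_iff forall_2 root_spinor_def of_nat_hyp binet
    by (auto intro!: hyp.expand
        simp: algebra_simps power_add power2_eq_square power3_eq_cube simp del: of_real_divide)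
  then show ?thesis
    by (simp only:) (intro sums_hyp_vec_add sums_hyp_of_vector_mult exp_sums_weighted)
qed

text \<open>Subtracting the equations of two roots and cancelling the difference of the roots lowers
  the degree, so no factorisation of the cubic is needed.\<close>

lemma cubic_vieta:
  fixes a b c :: "'a :: idom"
  assumes roots: "a ^ 3 = a + 1" "b ^ 3 = b + 1" "c ^ 3 = c + 1"
    and distinct: "a \<noteq> b" "a \<noteq> c" "b \<noteq> c"
  shows "a + b + c = 0" and "a * b + a * c + b * c = - 1"
proof -
  have "(a - b) * (a ^ 2 + a * b + b ^ 2 - 1) = 0" "(a - c) * (a ^ 2 + a * c + c ^ 2 - 1) = 0"
    using roots by algebra+
  then have *: "a ^ 2 + a * b + b ^ 2 - 1 = 0" "a ^ 2 + a * c + c ^ 2 - 1 = 0"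
    using distinct by auto
  \<comment> \<open>This product is the difference of the two equations in \<open>*\<close>.\<close>
  then have "(b - c) * (a + b + c) = 0"
    by algebra
  then show "a + b + c = 0"
    using distinct by simp
  \<comment> \<open>Substituting c = -(a + b) gives -(a^2 + a b + b^2), which is -1 by
    \<open>*\<close>.\<close>
  with * show "a * b + a * c + b * c = - 1"
    by algebra
qed

text \<open>The \<open>Suc\<close> form matches the recursive cases of \<open>padovan.induct\<close>
  and \<open>perrin.induct\<close>, so it can be unfolded there directly.\<close>

lemma cubic_power_rec:
  fixes x :: "'a :: comm_ring_1"
  assumes "x ^ 3 = x + 1"
  shows "x ^ Suc (Suc (Suc n)) = x ^ Suc n + x ^ n"
proof -
  have "x ^ Suc (Suc (Suc n)) = x ^ 3 * x ^ n"
    by (simp add: power3_eq_cube mult.assoc)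
  then show ?thesis
    by (simp add: assms algebra_simps)
qed

lemma padovan_coeff_interpolation:
  assumes "a \<noteq> b" "a \<noteq> c" "b \<noteq> c" and "k \<le> 2"
  shows "padovan_coeff a b c * a ^ k + padovan_coeff b a c * b ^ k + padovan_coeff c a b * c ^ k = 1"
proof -
  \<comment> \<open>The Vandermonde product is a common denominator of the three weights; clearing
    it leaves a polynomial identity for each k.\<close>
  define d where "d = (a - b) * (a - c) * (b - c)"
  have nz: "d \<noteq> 0"
    using assms by (simp add: d_def)
  have coeffs:
    "padovan_coeff a b c = (b - 1) * (c - 1) * (b - c) / d"
    "padovan_coeff b a c = - ((a - 1) * (c - 1) * (a - c)) / d"
    "padovan_coeff c a b = (a - 1) * (b - 1) * (a - b) / d"
    using assms unfolding padovan_coeff_def d_def by (simp_all add: divide_simps) (simp_all add: algebra_simps)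
  have "(b - 1) * (c - 1) * (b - c) * a ^ k - (a - 1) * (c - 1) * (a - c) * b ^ k
      + (a - 1) * (b - 1) * (a - b) * c ^ k = d"
  proof -
    consider "k = 0" | "k = 1" | "k = 2"
      using \<open>k \<le> 2\<close> by linarith
    then show ?thesis
      by cases (simp_all add: d_def algebra_simps power2_eq_square)
  qed
  with nz have "((b - 1) * (c - 1) * (b - c) * a ^ k - (a - 1) * (c - 1) * (a - c) * b ^ k
      + (a - 1) * (b - 1) * (a - b) * c ^ k) / d = 1"
    by simp
  then show ?thesis
    unfolding coeffs by (simp only: add_divide_distrib diff_divide_distrib) simp
qed

lemma padovan_binet:
  assumes roots: "a ^ 3 = a + 1" "b ^ 3 = b + 1" "c ^ 3 = c + 1"
    and distinct: "a \<noteq> b" "a \<noteq> c" "b \<noteq> c"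
  shows "of_nat (padovan n)
    = padovan_coeff a b c * a ^ n + padovan_coeff b a c * b ^ n + padovan_coeff c a b * c ^ n"
proof (induction n rule: padovan.induct)
  case 1
  show ?case using padovan_coeff_interpolation [OF distinct, of 0] by simp
next
  case 2
  show ?case using padovan_coeff_interpolation [OF distinct, of 1] by simp
next
  case 3
  show ?case using padovan_coeff_interpolation [OF distinct, of 2] by (simp add: numeral_2_eq_2)
next
  case (4 n)
  then show ?case
    unfolding cubic_power_rec [OF roots(1)] cubic_power_rec [OF roots(2)] cubic_power_rec [OF roots(3)]
    by (simp add: distrib_left)
qed

lemma perrin_binet:
  fixes a b c :: "'a :: idom"
  assumes roots: "a ^ 3 = a + 1" "b ^ 3 = b + 1" "c ^ 3 = c + 1"
    and distinct: "a \<noteq> b" "a \<noteq> c" "b \<noteq> c"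
  shows "of_nat (perrin n) = a ^ n + b ^ n + c ^ n"
proof (induction n rule: perrin.induct)
  case 2
  show ?case using cubic_vieta(1) [OF assms] by simp
next
  case 3
  \<comment> \<open>The sum of squares is (a + b + c)^2 - 2 (a b + a c + b c) = 0 + 2.\<close>
  have "a ^ 2 + b ^ 2 + c ^ 2 = 2"
    using cubic_vieta [OF assms] by algebra
  then show ?case by (simp add: numeral_2_eq_2)
next
  case (4 n)
  then show ?case
    unfolding cubic_power_rec [OF roots(1)] cubic_power_rec [OF roots(2)] cubic_power_rec [OF roots(3)]
    by simp
qed simp

theorem theorem15:
  fixes \<alpha> \<beta> \<gamma> :: complex and y :: real
  assumes roots: "{x :: complex. x ^ 3 - x - 1 = 0} = {\<alpha>, \<beta>, \<gamma>}"
    and "distinct [\<alpha>, \<beta>, \<gamma>]"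
    and "\<alpha> \<in> \<real>"
    and "\<gamma> = cnj \<beta>"
    and "Im \<beta> > 0"
  shows "(\<lambda>n. hyp_of (of_real (y ^ n / fact n)) *s padovan_spinor n) sums
           (hyp_of (padovan_coeff \<alpha> \<beta> \<gamma> * exp (\<alpha> * of_real y)) *s root_spinor \<alpha>
            + hyp_of (padovan_coeff \<beta> \<alpha> \<gamma> * exp (\<beta> * of_real y)) *s root_spinor \<beta>
            + hyp_of (padovan_coeff \<gamma> \<alpha> \<beta> * exp (\<gamma> * of_real y)) *s root_spinor \<gamma>)
       \<and> (\<lambda>n. hyp_of (of_real (y ^ n / fact n)) *s perrin_spinor n) sums
           (hyp_of (exp (\<alpha> * of_real y)) *s root_spinor \<alpha>
            + hyp_of (exp (\<beta> * of_real y)) *s root_spinor \<beta>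
            + hyp_of (exp (\<gamma> * of_real y)) *s root_spinor \<gamma>)"
proof -
  have root: "x ^ 3 = x + 1" if "x \<in> {\<alpha>, \<beta>, \<gamma>}" for x
    using that unfolding roots [symmetric] by (simp add: algebra_simps)
  have cubes: "\<alpha> ^ 3 = \<alpha> + 1" "\<beta> ^ 3 = \<beta> + 1" "\<gamma> ^ 3 = \<gamma> + 1"
    by (simp_all add: root)
  have neq: "\<alpha> \<noteq> \<beta>" "\<alpha> \<noteq> \<gamma>" "\<beta> \<noteq> \<gamma>"
    using \<open>distinct [\<alpha>, \<beta>, \<gamma>]\<close> by auto
  \<comment> \<open>The explicit factors 1 are the weights p, q, r that \<open>spinor_egf\<close>
    expects.\<close>
  have "of_nat (perrin n) = 1 * \<alpha> ^ n + 1 * \<beta> ^ n + 1 * \<gamma> ^ n" for n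
    using perrin_binet [OF cubes neq] by simp
  from spinor_egf [of padovan, OF padovan_binet [OF cubes neq]] spinor_egf [of perrin, OF this]
  show ?thesis
    unfolding padovan_spinor_def perrin_spinor_def by simp
qed

end
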